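(* Let $\alpha:\mathbb{R}\to\mathbb{R}^2\equiv\{x_3=0\}\subset\mathbb{R}^3$ be a smooth, $L$-periodic, arc-length parametrized curve whose trace $C$ is a simple closed curve of length $L$, traversed counterclockwise, and let $\Omega$ be the bounded domain enclosed by $C$, with area $|\Omega|$. For $l>0$ let $M$ be the cylindrical column $x(t,s)=\alpha(s)+tE_3$, $t\in[0,l]$, $s\in[0,L]$, oriented by $N(t,s)=E_3\wedge\alpha'(s)$, and suppose $2H=a(x_1^2+x_2^2)+b$ on $M$ for constants $a,b$. If $a\ge 0$, $b>0$ and $M$ is stable, then $$l\le 2\pi\sqrt{\frac{L}{4a|\Omega|+Lb^2}}.$$
   Context: $E_1,E_2,E_3$ is the standard basis of $\mathbb{R}^3$, $\wedge$ the cross product. The curvature $\kappa$ of $\alpha$ is defined by $\alpha''=\kappa\,\mathbf{n}$ with $\mathbf{n}=J\alpha'$, $J$ the counterclockwise rotation by $\pi/2$ in the $x_1x_2$-plane (so $N=\mathbf{n}$ and $2H=\kappa$). For a surface $M$ with Gauss map $N$, second fundamental form $\sigma$, Laplace–Beltrami operator $\Delta$, support function $h=\langle N,x\rangle$, $N_3=\langle N,E_3\rangle$, $x_3=\langle x,E_3\rangle$, satisfying $2H=a(x_1^2+x_2^2)+b$, stability means: $\Phi(u):=-\int_M u\big(\Delta u+(|\sigma|^2-2a(h-x_3N_3))u\big)\,dM\ge 0$ for every smooth $u$ on $M$ vanishing on the boundary $\partial M$ (here: on $t=0$ and $t=l$, and $L$-periodic in $s$) with $\int_M u\,dM=0$.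 For the column, $\Delta=\partial_t^2+\partial_s^2$, $|\sigma|^2=\kappa(s)^2$ and $h-x_3N_3=-\langle\alpha(s)\wedge\alpha'(s),E_3\rangle$. *)

theory Defs
  imports "HOL-Analysis.Analysis"
begin

definition smooth_fun :: "(real \<Rightarrow> real) \<Rightarrow> bool" where
  "smooth_fun f \<longleftrightarrow> (\<forall>n x. ((deriv ^^ n) f) differentiable (at x))"

definition pd_t :: "(real \<Rightarrow> real \<Rightarrow> real) \<Rightarrow> real \<Rightarrow> real \<Rightarrow> real" where
  "pd_t u = (\<lambda>t s. deriv (\<lambda>t'. u t' s) t)"

definition pd_s :: "(real \<Rightarrow> real \<Rightarrow> real) \<Rightarrow> real \<Rightarrow> real \<Rightarrow> real" where
  "pd_s u = (\<lambda>t s. deriv (\<lambda>s'. u t s') s)"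

definition smooth2 :: "(real \<Rightarrow> real \<Rightarrow> real) \<Rightarrow> bool" where
  "smooth2 u \<longleftrightarrow>
     (\<forall>bs :: bool list.
        let v = foldr (\<lambda>b f. if b then pd_t f else pd_s f) bs u in
          continuous_on UNIV (\<lambda>p. v (fst p) (snd p)) \<and>
          (\<forall>t s. (\<lambda>t'. v t' s) differentiable (at t) \<and> (\<lambda>s'. v t s') differentiable (at s)))"

definition Jrot :: "real \<times> real \<Rightarrow> real \<times> real" where
  "Jrot v = (- snd v, fst v)"

text \<open>Stability of the column x(t,s) = alpha(s) + t E3, t in [0,l], s in [0,L],
  with alpha = (a1,a2) arc-length parametrized, curvature kappa, and
  2H = a (x1^2+x2^2) + b.  The Jacobi-type form is
  Phi(u) = - int int u (u_tt + u_ss + (|sigma|^2 - 2a(h - x3 N3)) u),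
  where |sigma|^2 = kappa^2 and h - x3 N3 = -(a1 a2' - a2 a1').\<close>
definition Phi_col ::
  "(real \<Rightarrow> real) \<Rightarrow> (real \<Rightarrow> real) \<Rightarrow> (real \<Rightarrow> real) \<Rightarrow> real \<Rightarrow> real \<Rightarrow> real
     \<Rightarrow> (real \<Rightarrow> real \<Rightarrow> real) \<Rightarrow> real" where
  "Phi_col a1 a2 \<kappa> a l L u =
     - integral {0..l} (\<lambda>t. integral {0..L} (\<lambda>s.
         u t s * (pd_t (pd_t u) t s + pd_s (pd_s u) t s
           + ((\<kappa> s)\<^sup>2 - 2 * a * (- (a1 s * deriv a2 s - a2 s * deriv a1 s))) * u t s)))"

definition column_stable ::
  "(real \<Rightarrow> real) \<Rightarrow> (real \<Rightarrow> real) \<Rightarrow> (real \<Rightarrow> real) \<Rightarrow> real \<Rightarrow> real \<Rightarrow> real \<Rightarrow> bool" where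
  "column_stable a1 a2 \<kappa> a l L \<longleftrightarrow>
     (\<forall>u. smooth2 u \<and> (\<forall>t s. u t (s + L) = u t s) \<and> (\<forall>s. u 0 s = 0 \<and> u l s = 0)
          \<and> integral {0..l} (\<lambda>t. integral {0..L} (\<lambda>s. u t s)) = 0
        \<longrightarrow> Phi_col a1 a2 \<kappa> a l L u \<ge> 0)"

end

theory Submission
  imports Defs
begin

text \<open>
  Testing stability with \<open>u = sin (2\<pi>t/l)\<close> gives
  \<open>\<integral> \<kappa>\<^sup>2 + 2a f ds \<le> 4\<pi>\<^sup>2 L / l\<^sup>2\<close>, where \<open>f = \<langle>\<alpha> \<and> \<alpha>', E\<^sub>3\<rangle>\<close>.
  With \<open>\<rho> = |\<alpha>|\<^sup>2\<close> one has \<open>\<kappa>\<^sup>2 = b\<^sup>2 + a (a\<rho>\<^sup>2 + 2b\<rho>)\<close>, so it suffices that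
  \<open>4|\<Omega>| \<le> \<integral> a\<rho>\<^sup>2 + 2b\<rho> + 2f\<close>.

  Green's formula \<open>2|\<Omega>| = \<integral> f\<close> is avoided. Every ray from the origin through a point of \<open>\<Omega>\<close>
  must leave through \<open>C\<close>, so \<open>\<Omega>\<close> lies in the cone \<open>{r \<alpha>(s) | 0 \<le> r \<le> 1}\<close>, and the area formula for
  \<open>(r, s) \<mapsto> r \<alpha>(s)\<close> gives \<open>2|\<Omega>| \<le> \<integral> |f|\<close>.
  It remains to absorb the negative part of \<open>f\<close>, i.e. to show \<open>0 \<le> \<integral> a\<rho>\<^sup>2 + 2b\<rho> + 2f - 2|f|\<close>.
  The curvature equation has the first integral \<open>f = a\<rho>\<^sup>2/4 + b\<rho>/2 + c\<close>. If \<open>c \<ge> 0\<close>, then \<open>f \<ge> 0\<close>.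
  If \<open>c < 0\<close>, the curve avoids the origin and the oriented angle \<open>\<theta>\<close> from \<open>\<alpha>\<close> to \<open>\<alpha>'\<close> satisfies
  \<open>\<theta>' = \<kappa> - f/\<rho>\<close> and \<open>sgn f = sgn (sin \<theta>)\<close>, hence \<open>\<integral> sgn f (\<kappa> - f/\<rho>) = 0\<close> over a period. A suitable
  multiple of this integrand is a pointwise lower bound for \<open>a\<rho>\<^sup>2 + 2b\<rho> + 2f - 2|f|\<close>.
\<close>

section \<open>A polynomial inequality in the squared distance from the origin\<close>

text \<open>
  Here \<open>x0\<close> is the value of \<open>|\<alpha>|\<^sup>2\<close> at which \<open>f\<close> vanishes; the factor in front of the sign is the
  ratio of \<open>a x\<^sup>2 + 2 b x\<close> to \<open>a x + b - f / x\<close> at \<open>x = x0\<close>.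
\<close>
lemma pointwise_area_bound:
  fixes a b x x0 f :: real
  assumes "a \<ge> 0" "b > 0" "x > 0" "x0 > 0"
    and f: "f = (a * x\<^sup>2 / 4 + b * x / 2) - (a * x0\<^sup>2 / 4 + b * x0 / 2)"
  shows "(a * x0\<^sup>2 + 2 * b * x0) / (a * x0 + b) * (sgn f * (a * x + b - f / x))
    \<le> a * x\<^sup>2 + 2 * b * x + 2 * f - 2 * \<bar>f\<bar>"
proof -
  \<comment> \<open>\<open>D\<close> is \<open>x * (a * x + b) - f\<close> with \<open>f\<close>
    expanded; in this form every coefficient is visibly nonnegative.\<close>
  define D where "D = 3 / 4 * a * x\<^sup>2 + b * x / 2 + a * x0\<^sup>2 / 4 + b * x0 / 2"
  have D: "a * x + b - f / x = D / x"
    using assms by (simp add: D_def f field_simps power2_eq_square)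
  have q: "a * x0 + b > 0" using assms by (simp add: add_nonneg_pos)
  consider "x = x0" | "x > x0" | "x < x0" by linarith
  then show ?thesis
  proof cases
    case 1
    then show ?thesis using assms by simp
  next
    case 2
    have fac: "f = (x - x0) * (a * (x + x0) / 4 + b / 2)"
      by (simp add: f field_simps power2_eq_square)
    have "0 \<le> a * (x + x0)" using assms by simp
    then have "0 < a * (x + x0) / 4 + b / 2" using assms(2) by linarith
    then have "f > 0" unfolding fac using 2 by (intro mult_pos_pos) auto
    moreover have "(a * x0\<^sup>2 + 2 * b * x0) * D \<le> (a * x\<^sup>2 + 2 * b * x) * ((a * x0 + b) * x)"
    proof -
      \<comment> \<open>The factor in front of the sign makes both sides agree at
        \<open>x = x0\<close>. Hence \<open>d\<close> divides the difference, and the cofactor is a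
        polynomial in \<open>x0\<close> and \<open>d\<close> with nonnegative coefficients.\<close>
      define d where "d = x - x0"
      have x: "x = x0 + d" and d: "d \<ge> 0" using 2 by (auto simp: d_def)
      have "(a * x\<^sup>2 + 2 * b * x) * ((a * x0 + b) * x) - (a * x0\<^sup>2 + 2 * b * x0) * D
        = d * (a\<^sup>2 * x0 * (3/2 * x0\<^sup>2 + 9/4 * x0 * d + d\<^sup>2)
             + a * b * (x0\<^sup>2 * 7 / 2 + x0 * d * 7 / 2 + d\<^sup>2) + b\<^sup>2 * (3 * x0 + 2 * d))"
        unfolding x D_def by (simp add: field_simps power2_eq_square)
      also have "\<dots> \<ge> 0"
        using assms d by (intro mult_nonneg_nonneg add_nonneg_nonneg) auto
      finally show ?thesis by simp
    qed
    ultimately show ?thesis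
      unfolding D using q assms(1-4) by (simp add: divide_simps) 
  next
    case 3
    have fac: "f = - ((x0 - x) * (a * (x + x0) / 4 + b / 2))"
      by (simp add: f field_simps power2_eq_square)
    have "0 \<le> a * (x + x0)" using assms by simp
    then have "0 < a * (x + x0) / 4 + b / 2" using assms(2) by linarith
    then have "0 < (x0 - x) * (a * (x + x0) / 4 + b / 2)" using 3 by (intro mult_pos_pos) auto
    then have "f < 0" unfolding fac by linarith
    moreover have "- ((a * x0\<^sup>2 + 2 * b * x0) * D)
      \<le> (4 * f + (a * x\<^sup>2 + 2 * b * x)) * ((a * x0 + b) * x)"
    proof -
      \<comment> \<open>Here \<open>4 * f + (a * x\<^sup>2 + 2 * b * x)\<close> equals twice
        \<open>a * x\<^sup>2 + 2 * b * x\<close> minus its value at \<open>x0\<close>. The claim is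
        shown first with the smaller \<open>x0 * (a * x0 + b)\<close> in place of
        \<open>a * x0\<^sup>2 + 2 * b * x0\<close> as the factor of \<open>D\<close>. The
        coefficients of \<open>a\<close> and \<open>b\<close> are handled by completing squares: the
        cubic has its minimum near \<open>x = 3/10 * x0\<close>, which suggests the first square,
        and the other constants follow by comparing coefficients.\<close>
      have "x0 * D - x * (a * x0\<^sup>2 + 2 * b * x0) + 2 * x * (a * x\<^sup>2 + 2 * b * x)
        = a * (2 * x * (x - 3/10 * x0)\<^sup>2 + 39/20 * x0 * (x - 59/195 * x0)\<^sup>2
               + (1/4 - 39/20 * (59/195)\<^sup>2) * x0 ^ 3)
          + b * ((2 * x - 3/8 * x0)\<^sup>2 + 23/64 * x0\<^sup>2)"
        unfolding D_def by (simp add: field_simps power2_eq_square power3_eq_cube)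
      also have "\<dots> \<ge> 0"
        using assms by (intro mult_nonneg_nonneg add_nonneg_nonneg) (auto simp: power2_eq_square)
      finally have "x * ((a * x0\<^sup>2 + 2 * b * x0) - 2 * (a * x\<^sup>2 + 2 * b * x)) * (a * x0 + b)
          \<le> x0 * D * (a * x0 + b)"
        using q by (intro mult_right_mono) (simp_all add: algebra_simps)
      also have "\<dots> \<le> (a * x0\<^sup>2 + 2 * b * x0) * D"
      proof -
        have "x0 * (a * x0 + b) \<le> a * x0\<^sup>2 + 2 * b * x0"
          using assms by (simp add: algebra_simps power2_eq_square)
        moreover have "D \<ge> 0" using assms by (simp add: D_def)
        ultimately have "x0 * (a * x0 + b) * D \<le> (a * x0\<^sup>2 + 2 * b * x0) * D"
          by (rule mult_right_mono)
        then show ?thesis by (simp only: mult_ac)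
      qed
      finally show ?thesis by (simp add: f algebra_simps)
    qed
    ultimately show ?thesis
      unfolding D using q assms(1-4) by (simp add: divide_simps)
  qed
qed

section \<open>Finiteness of simple zeros on a compact interval\<close>

text \<open>A limit point of zeros is itself a zero, and the difference quotients along the nearby
  zeros vanish, which contradicts a nonzero derivative. Compactness then leaves finitely many
  zeros.\<close>

lemma finite_simple_zeros:
  fixes f f' :: "real \<Rightarrow> real"
  assumes d: "\<And>s. (f has_real_derivative f' s) (at s)"
    and nz: "\<And>s. f s = 0 \<Longrightarrow> f' s \<noteq> 0"
  shows "finite {s \<in> {u..v}. f s = 0}"
proof -
  have "\<not> s islimpt {s. f s = 0}" for s
  proof
    assume lim: "s islimpt {s. f s = 0}"
    have "closed {s. f s = 0}"
      using d by (intro closed_Collect_eq continuous_intros)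
        (auto intro: DERIV_isCont continuous_at_imp_continuous_on)
    with lim have "f s = 0" by (auto simp: closed_limpt)
    have "((\<lambda>y. (f y - f s) / (y - s)) \<longlongrightarrow> f' s) (at s)"
      using d[of s] by (simp add: has_field_derivative_iff)
    then have "\<forall>\<^sub>F y in at s. (f y - f s) / (y - s) \<noteq> 0"
      using nz[OF \<open>f s = 0\<close>] by (rule tendsto_imp_eventually_ne)
    then have "\<forall>\<^sub>F y in at s. y \<notin> {s. f s = 0}"
      by eventually_elim (use \<open>f s = 0\<close> in auto)
    then show False using lim by (simp add: islimpt_iff_eventually)
  qed
  then have "finite ({u..v} \<inter> {s. f s = 0})"
    by (intro finite_not_islimpt_in_compact) auto
  then show ?thesis by (simp add: Int_def)
qed

section \<open>Closed unit-speed curves with curvature \<open>a * \<rho> + b\<close>\<close>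

locale column_profile =
  fixes X Y X' Y' :: "real \<Rightarrow> real" and a b L :: real
  assumes dX: "(X has_real_derivative X' s) (at s)"
    and dY: "(Y has_real_derivative Y' s) (at s)"
    and dX': "(X' has_real_derivative - ((a * ((X s)\<^sup>2 + (Y s)\<^sup>2) + b) * Y' s)) (at s)"
    and dY': "(Y' has_real_derivative (a * ((X s)\<^sup>2 + (Y s)\<^sup>2) + b) * X' s) (at s)"
    and unit_speed: "(X' s)\<^sup>2 + (Y' s)\<^sup>2 = 1"
    and closed_up: "X L = X 0" "Y L = Y 0" "X' L = X' 0" "Y' L = Y' 0"
    and L_pos: "L > 0" and a_nonneg: "a \<ge> 0" and b_pos: "b > 0"
begin

text \<open>\<open>f\<close> and \<open>p\<close> are the cross and inner products of position and
  velocity. With \<open>r = sqrt \<rho>\<close> and \<theta> the oriented angle from position to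
  velocity, \<open>p\<close> is r cos \<theta> and \<open>f\<close> is r sin \<theta>.\<close>

definition \<rho> where "\<rho> s = (X s)\<^sup>2 + (Y s)\<^sup>2"
definition f where "f s = X s * Y' s - Y s * X' s"
definition p where "p s = X s * X' s + Y s * Y' s"
definition \<kappa> where "\<kappa> s = a * \<rho> s + b"

lemma d\<rho>: "(\<rho> has_real_derivative 2 * p s) (at s)"
  unfolding \<rho>_def p_def
  by (rule derivative_eq_intros dX dY refl)+ (simp add: algebra_simps)

lemma df: "(f has_real_derivative \<kappa> s * p s) (at s)"
  unfolding f_def p_def \<kappa>_def \<rho>_def
  by (rule derivative_eq_intros dX dY dX' dY' refl)+ (simp add: algebra_simps)

lemma dp: "(p has_real_derivative 1 - \<kappa> s * f s) (at s)"
  unfolding f_def p_def \<kappa>_def \<rho>_def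
  by (rule derivative_eq_intros dX dY dX' dY' refl)+
    (use unit_speed[of s] in \<open>simp add: algebra_simps power2_eq_square\<close>)

lemma continuity: "continuous_on S X" "continuous_on S Y" "continuous_on S X'" "continuous_on S Y'"
  "continuous_on S \<rho>" "continuous_on S f" "continuous_on S p"
  using dX dY dX' dY' d\<rho> df dp by (meson DERIV_isCont continuous_at_imp_continuous_on)+

text \<open>Since \<open>\<rho>\<close> has derivative \<open>2 * p\<close> and \<open>f\<close> has
  derivative \<open>\<kappa> * p\<close>, \<open>f\<close> changes at the rate
  \<open>(a * \<rho> + b) / 2\<close> times that of \<open>\<rho>\<close>, so it is a quadratic
  polynomial in \<open>\<rho>\<close> up to a constant.\<close>

lemma first_integral: "\<exists>c. \<forall>s. f s = a * (\<rho> s)\<^sup>2 / 4 + b * \<rho> s / 2 + c"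
proof -
  have "((\<lambda>s. f s - (a * (\<rho> s)\<^sup>2 / 4 + b * \<rho> s / 2)) has_real_derivative 0) (at s)" for s
    by (auto intro!: derivative_eq_intros df d\<rho> simp: algebra_simps \<kappa>_def)
  from DERIV_isconst_all[OF allI[OF this]]
  have "f s = a * (\<rho> s)\<^sup>2 / 4 + b * \<rho> s / 2 + (f 0 - (a * (\<rho> 0)\<^sup>2 / 4 + b * \<rho> 0 / 2))" for s
    by (smt (verit))
  then show ?thesis by blast
qed

lemma Lagrange: "(p s)\<^sup>2 + (f s)\<^sup>2 = \<rho> s"
proof -
  have "(p s)\<^sup>2 + (f s)\<^sup>2 = \<rho> s * ((X' s)\<^sup>2 + (Y' s)\<^sup>2)"
    by (simp add: p_def f_def \<rho>_def power2_eq_square algebra_simps)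
  then show ?thesis by (simp add: unit_speed)
qed

text \<open>Away from the zeros of \<open>f\<close>, the unoriented angle between position and
  velocity has the integrand as its derivative. It takes the same value at \<open>0\<close> and
  \<open>L\<close>, whatever the winding of the oriented angle.\<close>

lemma signed_angle_integral:
  assumes \<rho>_pos: "\<And>s. \<rho> s > 0"
  shows "((\<lambda>s. sgn (f s) * (\<kappa> s - f s / \<rho> s)) has_integral 0) {0..L}"
proof -
  \<comment> \<open>the angle between position and velocity, folded into \<open>[0, \<pi>]\<close>: a periodic primitive of the integrand\<close>
  define K where "K = (\<lambda>s. arccos (p s / sqrt (\<rho> s)))"
  have bnd: "\<bar>p s / sqrt (\<rho> s)\<bar> \<le> 1" for s
  proof -
    have "\<bar>p s\<bar> \<le> sqrt (\<rho> s)" using Lagrange[of s] by (intro real_le_rsqrt) (simp flip: Lagrange)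
    then show ?thesis using \<rho>_pos[of s] by (simp add: abs_divide)
  qed
  \<comment> \<open>These are the points where the argument of \<open>arccos\<close> is 1 or -1.
    They are simple zeros: there \<open>p\<close> is nonzero by Lagrange's identity, and the
    curvature is positive.\<close>
  have "finite {s \<in> {0..L}. f s = 0}"
  proof (rule finite_simple_zeros[OF df])
    fix s assume "f s = 0"
    then have "p s \<noteq> 0" using Lagrange[of s] \<rho>_pos[of s] by auto
    moreover have "\<kappa> s > 0"
      using a_nonneg b_pos \<rho>_pos[of s] by (simp add: \<kappa>_def add_nonneg_pos)
    ultimately show "\<kappa> s * p s \<noteq> 0" by simp
  qed
  then have "((\<lambda>s. sgn (f s) * (\<kappa> s - f s / \<rho> s)) has_integral K L - K 0) {0..L}"
  proof (rule fundamental_theorem_of_calculus_strong)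
    show "continuous_on {0..L} K"
      unfolding K_def
    proof (intro continuous_intros continuity)
      show "\<forall>s\<in>{0..L}. sqrt (\<rho> s) \<noteq> 0" using \<rho>_pos by (metis less_irrefl real_sqrt_eq_zero_cancel_iff)
      show "\<forall>s\<in>{0..L}. - 1 \<le> p s / sqrt (\<rho> s) \<and> p s / sqrt (\<rho> s) \<le> 1"
        using bnd by (auto simp only: abs_le_iff minus_le_iff)
    qed
    fix s assume "s \<in> {0..L} - {s \<in> {0..L}. f s = 0}"
    then have f0: "f s \<noteq> 0" by auto
    define r where "r = sqrt (\<rho> s)"
    have r: "r > 0" "\<rho> s = r\<^sup>2" using \<rho>_pos[of s] by (auto simp: r_def)
    have lag: "(p s)\<^sup>2 + (f s)\<^sup>2 = r\<^sup>2" using Lagrange r by simp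
    have sq: "1 - (p s / r)\<^sup>2 = (f s / r)\<^sup>2"
      using lag r(1) by (simp add: power_divide field_simps)
    have "(p s / r)\<^sup>2 < 1" using sq f0 r(1) 
      by (smt (verit) divide_eq_0_iff zero_less_power2)
    then have "\<bar>p s / r\<bar> < 1" by (simp only: abs_square_less_1)
    then have lt: "- 1 < p s / r" "p s / r < 1" by linarith+
    have dq: "((\<lambda>s. p s / sqrt (\<rho> s)) has_real_derivative - (f s * (\<kappa> s - f s / \<rho> s) / r)) (at s)"
    proof -
      have "((\<lambda>s. p s / sqrt (\<rho> s)) has_real_derivative
          ((1 - \<kappa> s * f s) * r - p s * (2 * p s * (inverse r / 2))) / (r * r)) (at s)"
        unfolding r_def using \<rho>_pos[of s]
        by (auto intro!: derivative_eq_intros dp d\<rho> DERIV_real_sqrt[THEN DERIV_chain2])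
      moreover have "((1 - \<kappa> s * f s) * r - p s * (2 * p s * (inverse r / 2))) / (r * r)
          = (r\<^sup>2 - (p s)\<^sup>2 - \<kappa> s * f s * r\<^sup>2) / r ^ 3"
        using r(1) by (simp add: field_simps power2_eq_square power3_eq_cube)
      moreover have "\<dots> = - (f s * (\<kappa> s - f s / \<rho> s) / r)"
      proof -
        have "r\<^sup>2 - (p s)\<^sup>2 - \<kappa> s * f s * r\<^sup>2 = (f s)\<^sup>2 - \<kappa> s * f s * r\<^sup>2"
          using lag by simp
        moreover have "((f s)\<^sup>2 - \<kappa> s * f s * r\<^sup>2) / r ^ 3 = - (f s * (\<kappa> s - f s / r\<^sup>2) / r)"
          using r(1) by (simp add: field_simps power2_eq_square power3_eq_cube)
        ultimately show ?thesis by (simp only: r(2))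
      qed
      ultimately show ?thesis by simp
    qed
    have "(K has_real_derivative inverse (- sqrt (1 - (p s / r)\<^sup>2)) * - (f s * (\<kappa> s - f s / \<rho> s) / r)) (at s)"
      unfolding K_def using DERIV_chain2[OF DERIV_arccos dq] lt by (simp add: r_def)
    moreover have "inverse (- sqrt (1 - (p s / r)\<^sup>2)) * - (f s * (\<kappa> s - f s / \<rho> s) / r)
        = sgn (f s) * (\<kappa> s - f s / \<rho> s)"
    proof -
      have "sqrt (1 - (p s / r)\<^sup>2) = \<bar>f s\<bar> / r"
        unfolding sq using r(1) by (simp only: real_sqrt_abs abs_divide abs_of_pos)
      then show ?thesis using r(1) f0 by (simp add: sgn_if)
    qed
    ultimately show "(K has_vector_derivative sgn (f s) * (\<kappa> s - f s / \<rho> s)) (at s)"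
      by (simp add: has_real_derivative_iff_has_vector_derivative)
  qed (use L_pos in simp)
  moreover have "K L = K 0" by (simp add: K_def p_def \<rho>_def closed_up)
  ultimately show ?thesis by simp
qed

lemma area_comparison:
  "integral {0..L} (\<lambda>s. 2 * \<bar>f s\<bar>) \<le> integral {0..L} (\<lambda>s. a * (\<rho> s)\<^sup>2 + 2 * b * \<rho> s + 2 * f s)"
proof -
  obtain c where c: "\<And>s. f s = a * (\<rho> s)\<^sup>2 / 4 + b * \<rho> s / 2 + c"
    using first_integral by blast
  have \<rho>_nonneg: "\<rho> s \<ge> 0" for s by (simp add: \<rho>_def)
  have int: "(\<lambda>s. 2 * \<bar>f s\<bar>) integrable_on {0..L}"
    "(\<lambda>s. a * (\<rho> s)\<^sup>2 + 2 * b * \<rho> s + 2 * f s) integrable_on {0..L}"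
    by (intro integrable_continuous_real continuous_intros continuity)+
  show ?thesis
  proof (cases "c \<ge> 0")
    case True
    have "2 * \<bar>f s\<bar> \<le> a * (\<rho> s)\<^sup>2 + 2 * b * \<rho> s + 2 * f s" for s
    proof -
      have nn: "a * (\<rho> s)\<^sup>2 \<ge> 0" "b * \<rho> s \<ge> 0"
        using a_nonneg b_pos \<rho>_nonneg[of s] by auto
      then have "f s \<ge> 0" using c[of s] True by linarith
      then show ?thesis using nn by linarith
    qed
    then show ?thesis by (intro integral_le int)
  next
    case False
    \<comment> \<open>At the origin \<open>f\<close> would be 0 by Lagrange's identity, but equal to
      \<open>c < 0\<close> by the first integral.\<close>
    have \<rho>_pos: "\<rho> s > 0" for s
    proof (rule ccontr)
      assume "\<not> \<rho> s > 0"
      then have "\<rho> s = 0" using \<rho>_nonneg[of s] by simp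
      then have "f s = 0" using Lagrange[of s] by (simp add: sum_power2_eq_zero_iff)
      then show False using c[of s] False \<open>\<rho> s = 0\<close> by simp
    qed
    \<comment> \<open>\<open>x0\<close> is the zero of the first integral as a function of
      \<open>\<rho>\<close>. The upper end \<open>- 2 * c / b\<close> is where the linear term alone
      reaches \<open>- c\<close>.\<close>
    have "\<exists>x\<ge>0. x \<le> - 2 * c / b \<and> a * x\<^sup>2 / 4 + b * x / 2 = - c"
    proof (rule IVT')
      show "- c \<le> a * (- 2 * c / b)\<^sup>2 / 4 + b * (- 2 * c / b) / 2"
        using a_nonneg b_pos by simp
    qed (use False b_pos in \<open>auto intro!: continuous_intros simp: divide_simps\<close>)
    then obtain x0 where x0: "x0 \<ge> 0" "a * x0\<^sup>2 / 4 + b * x0 / 2 = - c" by blast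
    then have "x0 \<noteq> 0" using False by auto
    with x0 have "x0 > 0" by simp
    define \<mu> where "\<mu> = (a * x0\<^sup>2 + 2 * b * x0) / (a * x0 + b)"
    have "((\<lambda>s. \<mu> * (sgn (f s) * (\<kappa> s - f s / \<rho> s))) has_integral \<mu> * 0) {0..L}"
      by (intro has_integral_mult_right signed_angle_integral \<rho>_pos)
    moreover have "((\<lambda>s. (a * (\<rho> s)\<^sup>2 + 2 * b * \<rho> s + 2 * f s) - 2 * \<bar>f s\<bar>) has_integral
        integral {0..L} (\<lambda>s. a * (\<rho> s)\<^sup>2 + 2 * b * \<rho> s + 2 * f s) - integral {0..L} (\<lambda>s. 2 * \<bar>f s\<bar>)) {0..L}"
      by (intro has_integral_diff integrable_integral int)
    ultimately have "\<mu> * 0 \<le> integral {0..L} (\<lambda>s. a * (\<rho> s)\<^sup>2 + 2 * b * \<rho> s + 2 * f s)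
        - integral {0..L} (\<lambda>s. 2 * \<bar>f s\<bar>)"
    proof (rule has_integral_le)
      fix s
      have "f s = (a * (\<rho> s)\<^sup>2 / 4 + b * \<rho> s / 2) - (a * x0\<^sup>2 / 4 + b * x0 / 2)"
        using c[of s] x0(2) by simp
      from pointwise_area_bound[OF a_nonneg b_pos \<rho>_pos \<open>x0 > 0\<close> this]
      show "\<mu> * (sgn (f s) * (\<kappa> s - f s / \<rho> s))
          \<le> (a * (\<rho> s)\<^sup>2 + 2 * b * \<rho> s + 2 * f s) - 2 * \<bar>f s\<bar>"
        by (simp add: \<mu>_def \<kappa>_def)
    qed
    then show ?thesis by simp
  qed
qed

end

section \<open>Area enclosed by a closed curve, bounded by the area of a cone\<close>

text \<open>The region lives in \<open>real \<times> real\<close>, whereas determinants and the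
  measure of differentiable images are formulated over \<open>real^2\<close>; this map
  mediates.\<close>

abbreviation pair_of_vec :: "real^2 \<Rightarrow> real \<times> real" where
  "pair_of_vec v \<equiv> (v $ 1, v $ 2)"

lemma measurable_pair_of_vec [measurable]: "pair_of_vec \<in> borel \<rightarrow>\<^sub>M borel"
  by (intro borel_measurable_continuous_onI continuous_intros)

text \<open>Lebesgue measure is determined by its values on boxes, and the coordinate map pulls a
  box back to one with the same side lengths.\<close>

lemma lborel_pair_eq_distr_vec2:
  "(lborel :: (real \<times> real) measure) = distr (lborel :: (real^2) measure) borel pair_of_vec"
proof (rule lborel_eqI)
  fix l u :: "real \<times> real"
  assume le: "\<And>b. b \<in> Basis \<Longrightarrow> l \<bullet> b \<le> u \<bullet> b"
  define l' u' :: "real^2" where "l' = vector [fst l, snd l]" and "u' = vector [fst u, snd u]"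
  have le': "fst l \<le> fst u" "snd l \<le> snd u"
    using le[of "(1,0)"] le[of "(0,1)"] by (auto simp: Basis_prod_def inner_prod_def)
  have B2: "(Basis :: (real^2) set) = {axis 1 1, axis 2 1}"
    by (auto simp: Basis_vec_def UNIV_2)
  have Bp: "(Basis :: (real \<times> real) set) = {(1, 0), (0, 1)}"
    by (auto simp: Basis_prod_def)
  have "pair_of_vec -` box l u = box l' u'"
    by (auto simp: mem_box_cart forall_2 l'_def u'_def mem_box Basis_prod_def inner_prod_def)
  moreover have "emeasure lborel (box l' u') = ennreal (\<Prod>b\<in>Basis. (u' - l') \<bullet> b)"
    by (rule emeasure_lborel_box)
      (use le' in \<open>auto simp: B2 inner_axis l'_def u'_def\<close>)
  moreover have "(\<Prod>b\<in>Basis. (u' - l') \<bullet> b) = (fst u - fst l) * (snd u - snd l)"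
    by (simp add: B2 axis_eq_axis inner_axis l'_def u'_def)
  moreover have "(\<Prod>b\<in>Basis. (u - l) \<bullet> b) = (fst u - fst l) * (snd u - snd l)"
    by (simp add: Bp inner_prod_def)
  ultimately show "emeasure (distr lborel borel pair_of_vec) (box l u) = ennreal (\<Prod>b\<in>Basis. (u - l) \<bullet> b)"
    by (simp add: emeasure_distr)
qed simp

text \<open>Otherwise the ray from \<open>p\<close> away from the origin, connected and unbounded,
  would lie in the bounded component of \<open>p\<close> in the complement of
  \<open>C\<close>.\<close>

lemma inside_subset_cone:
  fixes C :: "'a::real_normed_vector set"
  assumes "p \<in> inside C" "p \<noteq> 0"
  shows "\<exists>t\<ge>1. t *\<^sub>R p \<in> C"
proof (rule ccontr)
  assume no: "\<not> ?thesis"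
  let ?R = "(\<lambda>t. t *\<^sub>R p) ` {1..}"
  have "connected ?R"
    by (intro connected_continuous_image continuous_intros) auto
  moreover have "?R \<subseteq> - C" using no by auto
  moreover have "p \<in> ?R" by (rule image_eqI[of _ _ 1]) auto
  ultimately have "?R \<subseteq> connected_component_set (- C) p"
    by (rule connected_component_maximal[rotated, of _ _])
  moreover have "bounded (connected_component_set (- C) p)"
    using assms by (simp add: inside_def)
  ultimately have "bounded ?R" by (rule bounded_subset[rotated])
  then obtain B where B: "\<And>t. t \<ge> 1 \<Longrightarrow> norm (t *\<^sub>R p) \<le> B"
    by (auto simp: bounded_iff)
  have "norm ((max 1 ((B + 1) / norm p)) *\<^sub>R p) \<ge> B + 1"
  proof -
    have "B + 1 = (B + 1) / norm p * norm p" using assms(2) by simp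
    also have "\<dots> \<le> max 1 ((B + 1) / norm p) * norm p" by (intro mult_right_mono) auto
    finally show ?thesis by simp
  qed
  with B[of "max 1 ((B + 1) / norm p)"] show False by linarith
qed

text \<open>The cone map sends \<open>(r, s)\<close> to \<open>r\<close> times the curve point at
  \<open>s\<close> and covers the enclosed region. Its Jacobian is \<open>r\<close> times the cross
  product of position and velocity, and integrating \<open>r\<close> over the unit interval gives
  the factor 1/2. Overlaps only enlarge the right side.\<close>

lemma measure_inside_le:
  fixes X Y X' Y' :: "real \<Rightarrow> real"
  assumes dX: "\<And>s. (X has_real_derivative X' s) (at s)"
    and dY: "\<And>s. (Y has_real_derivative Y' s) (at s)"
    and cX': "continuous_on UNIV X'" and cY': "continuous_on UNIV Y'"
    and "L > 0"
  defines "C \<equiv> (\<lambda>s. (X s, Y s)) ` {0..L}"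
  shows "2 * measure lebesgue (inside C) \<le> integral {0..L} (\<lambda>s. \<bar>X s * Y' s - Y s * X' s\<bar>)"
proof -
  let ?f = "\<lambda>s. X s * Y' s - Y s * X' s"
  have cX: "continuous_on S X" and cY: "continuous_on S Y" for S
    using dX dY by (meson DERIV_isCont continuous_at_imp_continuous_on)+
  have cf: "continuous_on S ?f" for S
    by (intro continuous_intros cX cY continuous_on_subset[OF cX'] continuous_on_subset[OF cY']) auto
  have "compact C"
    unfolding C_def by (intro compact_continuous_image continuous_intros cX cY) auto
  then have "open (inside C)" by (simp add: compact_imp_closed open_inside)
  then have meas [measurable]: "inside C \<in> sets borel" by simp
  define V :: "(real^2) set" where "V = pair_of_vec -` inside C"
  have [measurable]: "V \<in> sets borel"
    unfolding V_def using measurable_sets_borel[OF measurable_pair_of_vec meas] by simp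
  have "measure lebesgue (inside C) = measure (lborel :: (real \<times> real) measure) (inside C)"
    using meas by simp
  also have "\<dots> = measure lborel V"
    by (subst lborel_pair_eq_distr_vec2) (simp add: measure_distr V_def)
  also have "\<dots> = measure lebesgue V" by simp
  finally have mV: "measure lebesgue (inside C) = measure lebesgue V" .
  define S :: "(real^2) set" where "S = cbox 0 (vector [1, L])"
  define F :: "real^2 \<Rightarrow> real^2" where "F = (\<lambda>v. vector [v $ 1 * X (v $ 2), v $ 1 * Y (v $ 2)])"
  define F' :: "real^2 \<Rightarrow> real^2 \<Rightarrow> real^2" where
    "F' = (\<lambda>v h. vector [h $ 1 * X (v $ 2) + v $ 1 * (X' (v $ 2) * h $ 2),
                         h $ 1 * Y (v $ 2) + v $ 1 * (Y' (v $ 2) * h $ 2)])"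
  have S_iff: "v \<in> S \<longleftrightarrow> 0 \<le> v $ 1 \<and> v $ 1 \<le> 1 \<and> 0 \<le> v $ 2 \<and> v $ 2 \<le> L" for v
    by (auto simp: S_def mem_box_cart forall_2)
  \<comment> \<open>The origin is the apex, reached at \<open>r = 0\<close>. Any other point
    \<open>v\<close> has a multiple \<open>t * v\<close> on the curve with \<open>t \<ge> 1\<close>,
    so \<open>r = 1 / t\<close> works.\<close>
  have sub: "V \<subseteq> F ` S"
  proof
    fix v assume "v \<in> V"
    then have v: "pair_of_vec v \<in> inside C" by (simp add: V_def)
    show "v \<in> F ` S"
    proof (cases "v = 0")
      case True
      then show ?thesis using \<open>L > 0\<close>
        by (intro image_eqI[of _ _ 0]) (auto simp: S_iff F_def vec_eq_iff forall_2)
    next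
      case False
      then have "pair_of_vec v \<noteq> 0" by (auto simp: vec_eq_iff forall_2 zero_prod_def)
      from inside_subset_cone[OF v this] obtain t s where
        t: "t \<ge> 1" and s: "s \<in> {0..L}" and "t *\<^sub>R pair_of_vec v = (X s, Y s)"
        by (auto simp: C_def)
      then have "v $ 1 = 1 / t * X s" "v $ 2 = 1 / t * Y s" by (auto simp: field_simps)
      then show ?thesis using t s
        by (intro image_eqI[of _ _ "vector [1 / t, s]"]) (auto simp: S_iff F_def vec_eq_iff forall_2)
    qed
  qed
  \<comment> \<open>The columns of the matrix are the curve point and \<open>v $ 1\<close> times the
    velocity.\<close>
  have det: "\<bar>det (matrix (F' v))\<bar> = \<bar>v $ 1\<bar> * \<bar>?f (v $ 2)\<bar>" for v
  proof -
    have "det (matrix (F' v)) = v $ 1 * ?f (v $ 2)"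
      by (simp add: det_2 matrix_def F'_def axis_def algebra_simps)
    then show ?thesis by (simp add: abs_mult)
  qed
  have cd: "continuous_on T (\<lambda>v::real^2. \<bar>v $ 1\<bar> * \<bar>?f (v $ 2)\<bar>)" for T
    by (intro continuous_intros continuous_on_compose2[OF cf[of UNIV]]
         continuous_on_compose2[OF cX[of UNIV]] continuous_on_compose2[OF cY[of UNIV]]
         continuous_on_compose2[OF cX'] continuous_on_compose2[OF cY']) auto
  have dF: "(F has_derivative F' v) (at v within S)" for v
  proof -
    have nth: "((\<lambda>v. v $ i) has_derivative (\<lambda>h. h $ i)) (at v within S)" for i
      by (rule bounded_linear_imp_has_derivative[OF bounded_linear_vec_nth])
    have 1: "((\<lambda>v. v $ 1 * X (v $ 2)) has_derivative
        (\<lambda>h. h $ 1 * X (v $ 2) + v $ 1 * (X' (v $ 2) * h $ 2))) (at v within S)"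
      by (rule has_derivative_eq_rhs, rule has_derivative_mult[OF nth
           has_derivative_compose[OF nth dX[unfolded has_field_derivative_def]]])
        (simp add: fun_eq_iff algebra_simps)
    have 2: "((\<lambda>v. v $ 1 * Y (v $ 2)) has_derivative
        (\<lambda>h. h $ 1 * Y (v $ 2) + v $ 1 * (Y' (v $ 2) * h $ 2))) (at v within S)"
      by (rule has_derivative_eq_rhs, rule has_derivative_mult[OF nth
           has_derivative_compose[OF nth dY[unfolded has_field_derivative_def]]])
        (simp add: fun_eq_iff algebra_simps)
    show ?thesis
      by (subst has_derivative_componentwise_within)
        (use 1 2 in \<open>auto simp: Basis_vec_def inner_axis F_def F'_def UNIV_2\<close>)
  qed
  have int: "(\<lambda>v. \<bar>det (matrix (F' v))\<bar>) integrable_on S"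
    unfolding det S_def by (intro integrable_continuous cd)
  have "measure lebesgue V \<le> measure lebesgue (F ` S)"
  proof (rule measure_mono_fmeasurable[OF sub])
    show "F ` S \<in> lmeasurable"
      by (rule measurable_differentiable_image[OF _ dF int]) (simp add: S_def)
  qed simp
  also have "\<dots> \<le> integral S (\<lambda>v. \<bar>det (matrix (F' v))\<bar>)"
    by (rule measure_differentiable_image[OF _ dF int]) (simp add: S_def)
  also have "\<dots> = integral {0..L} (\<lambda>s. \<bar>?f s\<bar>) / 2"
  proof -
    \<comment> \<open>The integral is moved back to pairs, where Fubini's theorem separates the
      variables.\<close>
    define G :: "real \<times> real \<Rightarrow> real" where "G = (\<lambda>q. \<bar>fst q\<bar> * \<bar>?f (snd q)\<bar>)"
    have cG: "continuous_on T G" for T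
      unfolding G_def
      by (intro continuous_intros continuous_on_compose2[OF cX[of UNIV]]
           continuous_on_compose2[OF cY[of UNIV]]
           continuous_on_compose2[OF cX'] continuous_on_compose2[OF cY']) auto
    let ?Q = "cbox (0, 0) (1, L) :: (real \<times> real) set"
    have intS: "set_integrable lborel S (\<lambda>v. \<bar>v $ 1\<bar> * \<bar>?f (v $ 2)\<bar>)"
      unfolding set_integrable_def by (rule borel_integrable_compact[OF _ cd]) (simp add: S_def)
    have intQ: "set_integrable lborel ?Q G"
      unfolding set_integrable_def by (rule borel_integrable_compact[OF _ cG]) simp
    have "integral S (\<lambda>v. \<bar>det (matrix (F' v))\<bar>) = (LINT v:S|lborel. \<bar>v $ 1\<bar> * \<bar>?f (v $ 2)\<bar>)"
      unfolding det using set_borel_integral_eq_integral(2)[OF intS] by simp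
    also have "\<dots> = (LINT v|lborel. indicator ?Q (pair_of_vec v) *\<^sub>R G (pair_of_vec v))"
      unfolding set_lebesgue_integral_def
      by (rule Bochner_Integration.integral_cong) (auto simp: G_def S_iff indicator_def)
    also have "\<dots> = (LINT q|distr lborel borel pair_of_vec. indicator ?Q q *\<^sub>R G q)"
    proof -
      have [measurable]: "G \<in> borel_measurable borel"
        using cG by (rule borel_measurable_continuous_onI)
      show ?thesis by (rule integral_distr[symmetric]) measurable
    qed
    also have "\<dots> = (LINT q:?Q|lborel. G q)"
      unfolding lborel_pair_eq_distr_vec2[symmetric] set_lebesgue_integral_def ..
    also have "\<dots> = integral ?Q G"
      using set_borel_integral_eq_integral(2)[OF intQ] .
    also have "\<dots> = integral {0..1} (\<lambda>r. integral {0..L} (\<lambda>s. G (r, s)))"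
      using integral_prod_continuous[OF cG, of 0 0 1 L] by simp
    also have "\<dots> = integral {0..1} (\<lambda>r. r * integral {0..L} (\<lambda>s. \<bar>?f s\<bar>))"
      by (rule integral_cong) (simp add: G_def)
    also have "\<dots> = integral {0..1} (\<lambda>r::real. r) * integral {0..L} (\<lambda>s. \<bar>?f s\<bar>)"
      by simp
    also have "integral {0..1} (\<lambda>r::real. r) = 1 / 2"
      using integral_unique[OF ident_has_integral[of 0 1]] by simp
    finally show ?thesis by simp
  qed
  finally show ?thesis using mV by simp
qed

section \<open>The test function and the stability inequality\<close>

text \<open>The span of \<open>sin (k * t)\<close> and \<open>cos (k * t)\<close> is invariant under
  both partial derivatives, the one in \<open>s\<close> being zero, so every iterated derivative
  stays in it.\<close>

lemma smooth2_trig: "smooth2 (\<lambda>t s. c * sin (k * t) + d * cos (k * t))"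
proof -
  define w :: "real \<Rightarrow> real \<Rightarrow> real \<Rightarrow> real \<Rightarrow> real"
    where "w = (\<lambda>c d t s. c * sin (k * t) + d * cos (k * t))"
  have pd: "pd_t (w c d) = w (- d * k) (c * k)" "pd_s (w c d) = w 0 0" for c d
    unfolding pd_t_def pd_s_def w_def
    by (auto intro!: ext DERIV_imp_deriv derivative_eq_intros simp: algebra_simps)
  have closed: "\<exists>c' d'. foldr (\<lambda>b f. if b then pd_t f else pd_s f) bs (w c d) = w c' d'" for bs
    by (induction bs) (auto simp: pd, blast+)
  have "continuous_on UNIV (\<lambda>p. w c' d' (fst p) (snd p)) \<and>
      (\<forall>t s. (\<lambda>t'. w c' d' t' s) differentiable (at t) \<and> (\<lambda>s'. w c' d' t s') differentiable (at s))"
    for c' d'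
    unfolding w_def real_differentiable_def
    by (auto intro!: continuous_intros exI derivative_eq_intros)
  then have "smooth2 (w c d)" unfolding smooth2_def Let_def by (metis closed)
  then show ?thesis by (simp add: w_def)
qed

text \<open>The test function is a full sine period over the height: it vanishes at both ends and
  has mean zero, while a half period would not. It is an eigenfunction of the Laplacian with
  eigenvalue \<open>- (2 * pi / l)\<^sup>2\<close>, so the form reduces to a negative multiple of
  the difference of the two sides.\<close>

lemma stable_column_energy:
  assumes "column_stable a1 a2 \<kappa> a l L" "l > 0" "L > 0"
    and int: "(\<lambda>s. (\<kappa> s)\<^sup>2 + 2 * a * (a1 s * deriv a2 s - a2 s * deriv a1 s)) integrable_on {0..L}"
  shows "integral {0..L} (\<lambda>s. (\<kappa> s)\<^sup>2 + 2 * a * (a1 s * deriv a2 s - a2 s * deriv a1 s))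
    \<le> L * (2 * pi / l)\<^sup>2"
proof -
  define k where "k = 2 * pi / l"
  define E where "E = (\<lambda>s. (\<kappa> s)\<^sup>2 + 2 * a * (a1 s * deriv a2 s - a2 s * deriv a1 s))"
  \<comment> \<open>The coefficients 1 and 0 put the sine in the shape of
    \<open>smooth2_trig\<close>.\<close>
  define u where "u = (\<lambda>t (s::real). 1 * sin (k * t) + 0 * cos (k * t))"
  have k: "k > 0" "k * l = 2 * pi" using \<open>l > 0\<close> by (auto simp: k_def)
  have sin_int: "((\<lambda>t. sin (k * t)) has_integral (- cos (k * l) / k - - cos (k * 0) / k)) {0..l}"
    using \<open>l > 0\<close> k(1)
    by (intro fundamental_theorem_of_calculus)
      (auto intro!: derivative_eq_intros simp flip: has_real_derivative_iff_has_vector_derivative)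
  \<comment> \<open>As \<open>k * l = 2 * pi\<close>, the boundary terms with sines vanish and the
    value is \<open>l / 2\<close>.\<close>
  have sin2_int: "((\<lambda>t. (sin (k * t))\<^sup>2) has_integral
      ((l / 2 - sin (k * l) * cos (k * l) / (2 * k)) - (0 / 2 - sin (k * 0) * cos (k * 0) / (2 * k)))) {0..l}"
  proof (intro fundamental_theorem_of_calculus)
    fix t
    have "((\<lambda>t. t / 2 - sin (k * t) * cos (k * t) / (2 * k)) has_real_derivative
        1 / 2 - (cos (k * t) * k * cos (k * t) + sin (k * t) * (- sin (k * t) * k)) / (2 * k)) (at t within {0..l})"
      using k(1) by (auto intro!: derivative_eq_intros simp: field_simps)
    moreover have "1 / 2 - (cos (k * t) * k * cos (k * t) + sin (k * t) * (- sin (k * t) * k)) / (2 * k) = (sin (k * t))\<^sup>2"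
    proof -
      have "1 / 2 - (cos (k * t) * k * cos (k * t) + sin (k * t) * (- sin (k * t) * k)) / (2 * k)
        = 1 / 2 - ((cos (k * t))\<^sup>2 - (sin (k * t))\<^sup>2) / 2"
        using k(1) by (simp add: field_simps power2_eq_square)
      then show ?thesis unfolding cos_squared_eq by (simp add: field_simps)
    qed
    ultimately show "((\<lambda>t. t / 2 - sin (k * t) * cos (k * t) / (2 * k)) has_vector_derivative
        (sin (k * t))\<^sup>2) (at t within {0..l})"
      by (simp add: has_real_derivative_iff_has_vector_derivative)
  qed (use \<open>l > 0\<close> in simp)
  have pd: "pd_t (pd_t u) = (\<lambda>t s. - (k\<^sup>2) * sin (k * t))" "pd_s (pd_s u) = (\<lambda>t s. 0)"
  proof -
    have 1: "pd_t u = (\<lambda>t s. k * cos (k * t))" "pd_s u = (\<lambda>t s. 0)"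
      unfolding pd_t_def pd_s_def u_def
      by (auto intro!: ext DERIV_imp_deriv derivative_eq_intros)
    show "pd_t (pd_t u) = (\<lambda>t s. - (k\<^sup>2) * sin (k * t))" "pd_s (pd_s u) = (\<lambda>t s. 0)"
      unfolding 1 unfolding pd_t_def pd_s_def
      by (auto intro!: ext DERIV_imp_deriv derivative_eq_intros simp: power2_eq_square)
  qed
  have "integral {0..l} (\<lambda>t. integral {0..L} (\<lambda>s. u t s)) = 0"
    using integral_unique[OF sin_int] \<open>L > 0\<close> by (simp add: u_def k(2))
  moreover have "smooth2 u" unfolding u_def by (rule smooth2_trig)
  ultimately have "0 \<le> Phi_col a1 a2 \<kappa> a l L u"
    using assms(1) k(2) unfolding column_stable_def by (simp add: u_def mult.commute)
  moreover have "Phi_col a1 a2 \<kappa> a l L u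
    = - integral {0..l} (\<lambda>t. (sin (k * t))\<^sup>2 * (integral {0..L} E - k\<^sup>2 * L))"
  proof -
    have "integral {0..L} (\<lambda>s. u t s * (pd_t (pd_t u) t s + pd_s (pd_s u) t s
           + ((\<kappa> s)\<^sup>2 - 2 * a * (- (a1 s * deriv a2 s - a2 s * deriv a1 s))) * u t s))
        = (sin (k * t))\<^sup>2 * (integral {0..L} E - k\<^sup>2 * L)" for t
    proof -
      have "integral {0..L} (\<lambda>s. u t s * (pd_t (pd_t u) t s + pd_s (pd_s u) t s
           + ((\<kappa> s)\<^sup>2 - 2 * a * (- (a1 s * deriv a2 s - a2 s * deriv a1 s))) * u t s))
        = integral {0..L} (\<lambda>s. (sin (k * t))\<^sup>2 * (E s - k\<^sup>2))"
        unfolding pd by (simp add: u_def E_def power2_eq_square algebra_simps)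
      also have "\<dots> = (sin (k * t))\<^sup>2 * (integral {0..L} E - k\<^sup>2 * L)"
        using \<open>L > 0\<close> by (simp add: integral_diff[OF int[folded E_def] integrable_const_ivl])
      finally show ?thesis .
    qed
    then show ?thesis unfolding Phi_col_def by simp
  qed
  moreover have "integral {0..l} (\<lambda>t. (sin (k * t))\<^sup>2 * (integral {0..L} E - k\<^sup>2 * L))
      = l / 2 * (integral {0..L} E - k\<^sup>2 * L)"
    using integral_unique[OF sin2_int] by (simp add: k(2))
  ultimately have "l / 2 * (integral {0..L} E - k\<^sup>2 * L) \<le> 0" by linarith
  then have "integral {0..L} E - k\<^sup>2 * L \<le> 0"
    using \<open>l > 0\<close> by (simp add: mult_le_0_iff)
  then show ?thesis by (simp add: E_def k_def mult.commute)
qed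

section \<open>The bound on the height of a stable column\<close>

theorem theorem2:
  fixes \<alpha> :: "real \<Rightarrow> real \<times> real" and \<kappa> :: "real \<Rightarrow> real"
    and L l a b :: real and C \<Omega> :: "(real \<times> real) set"
  assumes smooth: "smooth_fun (\<lambda>s. fst (\<alpha> s))" "smooth_fun (\<lambda>s. snd (\<alpha> s))"
    and L_pos: "L > 0"
    and periodic: "\<forall>s. \<alpha> (s + L) = \<alpha> s"
    and arclength: "\<forall>s. (deriv (\<lambda>s. fst (\<alpha> s)) s)\<^sup>2 + (deriv (\<lambda>s. snd (\<alpha> s)) s)\<^sup>2 = 1"
    and simple: "inj_on \<alpha> {0..<L}"
    and C_def: "C = \<alpha> ` {0..L}"
    and \<Omega>_def: "\<Omega> = inside C"
    and ccw: "\<forall>s. \<exists>\<epsilon>>0. \<forall>\<delta>. 0 < \<delta> \<and> \<delta> < \<epsilon> \<longrightarrow>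
               \<alpha> s + \<delta> *\<^sub>R Jrot (deriv (\<lambda>s. fst (\<alpha> s)) s, deriv (\<lambda>s. snd (\<alpha> s)) s) \<in> \<Omega>"
    and curvature: "\<forall>s. (deriv (deriv (\<lambda>s. fst (\<alpha> s))) s, deriv (deriv (\<lambda>s. snd (\<alpha> s))) s)
               = \<kappa> s *\<^sub>R Jrot (deriv (\<lambda>s. fst (\<alpha> s)) s, deriv (\<lambda>s. snd (\<alpha> s)) s)"
    and mean_curv: "\<forall>s. \<kappa> s = a * ((fst (\<alpha> s))\<^sup>2 + (snd (\<alpha> s))\<^sup>2) + b"
    and l_pos: "l > 0"
    and a_nonneg: "a \<ge> 0" and b_pos: "b > 0"
    and stable: "column_stable (\<lambda>s. fst (\<alpha> s)) (\<lambda>s. snd (\<alpha> s)) \<kappa> a l L"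
  shows "l \<le> 2 * pi * sqrt (L / (4 * a * measure lebesgue \<Omega> + L * b\<^sup>2))"
proof -
  define X where "X = (\<lambda>s. fst (\<alpha> s))"
  define Y where "Y = (\<lambda>s. snd (\<alpha> s))"
  have diff: "(g has_real_derivative deriv g s) (at s)"
    "(deriv g has_real_derivative deriv (deriv g) s) (at s)" if "smooth_fun g" for g s
    using that[unfolded smooth_fun_def, rule_format, of 0 s]
      that[unfolded smooth_fun_def, rule_format, of 1 s]
    by (auto simp: DERIV_deriv_iff_real_differentiable)
  have per: "X (s + L) = X s" "Y (s + L) = Y s" for s
    using periodic by (simp_all add: X_def Y_def)
  have per': "deriv g L = deriv g 0" if "\<And>s. g (s + L) = g s" for g :: "real \<Rightarrow> real"
  proof -
    \<comment> \<open>\<open>deriv\<close> selects a number by the derivative predicate, so it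
      suffices that this predicate agrees at the two points.\<close>
    have "(g has_real_derivative D) (at (0 + L)) \<longleftrightarrow> (g has_real_derivative D) (at 0)" for D
      using DERIV_shift[of g D 0 L] that by simp
    then show ?thesis by (simp add: deriv_def)
  qed
  have dd: "deriv (deriv X) s = - ((a * ((X s)\<^sup>2 + (Y s)\<^sup>2) + b) * deriv Y s)"
    "deriv (deriv Y) s = (a * ((X s)\<^sup>2 + (Y s)\<^sup>2) + b) * deriv X s" for s
    using curvature mean_curv by (simp_all add: X_def Y_def Jrot_def)
  have \<kappa>: "\<kappa> = (\<lambda>s. a * ((X s)\<^sup>2 + (Y s)\<^sup>2) + b)"
    using mean_curv by (auto simp: X_def Y_def)
  interpret column_profile X Y "deriv X" "deriv Y" a b L
  proof unfold_locales
    fix s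
    show "(X has_real_derivative deriv X s) (at s)" "(Y has_real_derivative deriv Y s) (at s)"
      using smooth diff by (auto simp: X_def Y_def)
    show "(deriv X has_real_derivative - ((a * ((X s)\<^sup>2 + (Y s)\<^sup>2) + b) * deriv Y s)) (at s)"
      "(deriv Y has_real_derivative (a * ((X s)\<^sup>2 + (Y s)\<^sup>2) + b) * deriv X s) (at s)"
      unfolding dd[symmetric] using smooth diff by (auto simp: X_def Y_def)
    show "(deriv X s)\<^sup>2 + (deriv Y s)\<^sup>2 = 1" using arclength by (simp add: X_def Y_def)
    show "X L = X 0" "Y L = Y 0" using per[of 0] by simp_all
    show "deriv X L = deriv X 0" "deriv Y L = deriv Y 0" using per' per by blast+
  qed (use L_pos a_nonneg b_pos in auto)
  let ?f = "\<lambda>s. X s * deriv Y s - Y s * deriv X s"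
  let ?\<rho> = "\<lambda>s. (X s)\<^sup>2 + (Y s)\<^sup>2"
  let ?A = "measure lebesgue \<Omega>"
  have C_eq: "C = (\<lambda>s. (X s, Y s)) ` {0..L}" by (simp add: C_def X_def Y_def)
  have "4 * ?A \<le> 2 * integral {0..L} (\<lambda>s. \<bar>?f s\<bar>)"
    using measure_inside_le[OF dX dY continuity(3) continuity(4) L_pos] by (simp add: \<Omega>_def C_eq)
  also have "\<dots> \<le> integral {0..L} (\<lambda>s. a * (?\<rho> s)\<^sup>2 + 2 * b * ?\<rho> s + 2 * ?f s)"
    using area_comparison by (simp add: \<rho>_def f_def)
  \<comment> \<open>Multiplying by \<open>a\<close> and adding \<open>L * b\<^sup>2\<close> turns
    the right-hand integrand into \<open>(\<kappa> s)\<^sup>2 + 2 * a * ?f s\<close>, the quantity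
    controlled by stability.\<close>
  finally have "a * (4 * ?A) + L * b\<^sup>2
      \<le> a * integral {0..L} (\<lambda>s. a * (?\<rho> s)\<^sup>2 + 2 * b * ?\<rho> s + 2 * ?f s) + L * b\<^sup>2"
    using a_nonneg by (simp add: mult_left_mono)
  also have "\<dots> = integral {0..L} (\<lambda>s. a * (a * (?\<rho> s)\<^sup>2 + 2 * b * ?\<rho> s + 2 * ?f s) + b\<^sup>2)"
    using L_pos by (subst integral_add) (auto intro!: integrable_continuous_real continuous_intros continuity)
  also have "\<dots> = integral {0..L} (\<lambda>s. (\<kappa> s)\<^sup>2 + 2 * a * ?f s)"
    by (rule integral_cong) (simp add: \<kappa> power2_eq_square algebra_simps)
  also have "\<dots> \<le> L * (2 * pi / l)\<^sup>2"
  proof (rule stable_column_energy[OF _ l_pos L_pos])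
    show "column_stable X Y \<kappa> a l L" using stable by (simp add: X_def Y_def)
    show "(\<lambda>s. (\<kappa> s)\<^sup>2 + 2 * a * ?f s) integrable_on {0..L}"
      unfolding \<kappa> by (intro integrable_continuous_real continuous_intros continuity)
  qed
  finally have le: "4 * a * ?A + L * b\<^sup>2 \<le> L * (2 * pi / l)\<^sup>2" by (simp add: mult_ac)
  have pos: "0 < 4 * a * ?A + L * b\<^sup>2"
    using a_nonneg b_pos L_pos by (intro add_nonneg_pos) auto
  have "(l / (2 * pi))\<^sup>2 \<le> L / (4 * a * ?A + L * b\<^sup>2)"
    using le pos l_pos by (simp add: field_simps power2_eq_square)
  then have "l / (2 * pi) \<le> sqrt (L / (4 * a * ?A + L * b\<^sup>2))"
    by (rule real_le_rsqrt)
  then show ?thesis by (simp add: field_simps)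
qed

end
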